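(* Let $p\ge 2$ be an integer, let $m\ge1$ and $0\le w\le m$ be integers, and let $S_w(0)\subseteq\mathbb{Z}_p^m$ be the set of vectors of Hamming weight $w$. There exists an embedding $$f:S_w(0)\hookrightarrow S^{(p-1)m-1}\subset\mathbb{R}^{(p-1)m}$$ (an injective map into the unit sphere) such that, whenever $b\le m$ is an integer satisfying $$\frac{w}{m}<J_p\!\left(\frac{b}{m}\right)$$ and $\mathcal{C}$ is any subset of $S_w(0)$ that satisfies $d(x,y)\ge b$ for all distinct $x,y\in\mathcal{C}$, the following hold: (1) for all distinct $x,y\in\mathcal{C}$, $\langle f(x),f(y)\rangle<0$, where $\langle\,\cdot\,,\,\cdot\,\rangle$ denotes the Euclidean inner product; and (2) $|\mathcal{C}|\le\min\{(p-1)m+1,\ \gamma(p,b,w,m)\}$, where $$\gamma(p,b,w,m):=\left\lfloor\frac{b}{\,b-m\,J_p^{-1}\!\left(\frac{w}{m}\right)}\right\rfloor .$$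
   Context: Here $\mathbb{Z}_p=\mathbb{Z}/p\mathbb{Z}$, with $p$ not necessarily prime. The Hamming weight $|x|$ of $x\in\mathbb{Z}_p^m$ is the number of nonzero entries of $x$, and the Hamming distance is $d(x,y)=|x-y|$. $|\mathcal{C}|$ denotes cardinality. The Johnson radius is the function $$J_p(\delta)=\left(1-\frac1p\right)\left(1-\sqrt{1-\frac{p}{p-1}\,\delta}\right),\qquad \delta\in\left[0,\tfrac{p-1}{p}\right].$$ It is an increasing bijection of $[0,\frac{p-1}{p}]$ onto itself, with inverse $J_p^{-1}(\omega)=2\omega-\frac{p}{p-1}\omega^2$. The condition $\frac{w}{m}<J_p(\frac{b}{m})$ is understood to include that $\frac bm$ lies in the domain $[0,\frac{p-1}{p}]$ of $J_p$. *)

theory Defs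
  imports "HOL-Analysis.Analysis" "HOL-Number_Theory.Number_Theory"
begin

(* residue_ring n has carrier {0..n-1} and operations modulo n, so vectors with entries in
   Z/pZ are functions on the index set {..<m} with values in that carrier, extensional so
   that equality of vectors is HOL equality. *)
definition residue_vectors :: "nat \<Rightarrow> nat \<Rightarrow> (nat \<Rightarrow> int) set" where
  "residue_vectors p m = {..<m} \<rightarrow>\<^sub>E carrier (residue_ring (int p))"

definition residue_vector_diff ::
    "nat \<Rightarrow> nat \<Rightarrow> (nat \<Rightarrow> int) \<Rightarrow> (nat \<Rightarrow> int) \<Rightarrow> (nat \<Rightarrow> int)" where
  "residue_vector_diff p m x y = (\<lambda>i\<in>{..<m}. x i \<ominus>\<^bsub>residue_ring (int p)\<^esub> y i)"

definition hamming_weight :: "nat \<Rightarrow> nat \<Rightarrow> (nat \<Rightarrow> int) \<Rightarrow> nat" where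
  "hamming_weight p m x = card {i \<in> {..<m}. x i \<noteq> \<zero>\<^bsub>residue_ring (int p)\<^esub>}"

definition hamming_dist :: "nat \<Rightarrow> nat \<Rightarrow> (nat \<Rightarrow> int) \<Rightarrow> (nat \<Rightarrow> int) \<Rightarrow> nat" where
  "hamming_dist p m x y = hamming_weight p m (residue_vector_diff p m x y)"

definition hamming_sphere :: "nat \<Rightarrow> nat \<Rightarrow> nat \<Rightarrow> (nat \<Rightarrow> int) set" where
  "hamming_sphere p m w = {x \<in> residue_vectors p m. hamming_weight p m x = w}"

definition johnson_domain :: "nat \<Rightarrow> real set" where
  "johnson_domain p = {0..(real p - 1) / real p}"

(* Meaningful for arguments in johnson_domain p only. *)
definition johnson_radius :: "nat \<Rightarrow> real \<Rightarrow> real" where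
  "johnson_radius p \<delta> =
     (1 - 1 / real p) * (1 - sqrt (1 - real p / (real p - 1) * \<delta>))"

definition johnson_radius_inv :: "nat \<Rightarrow> real \<Rightarrow> real" where
  "johnson_radius_inv p = inv_into (johnson_domain p) (johnson_radius p)"

definition johnson_gamma :: "nat \<Rightarrow> int \<Rightarrow> nat \<Rightarrow> nat \<Rightarrow> int" where
  "johnson_gamma p b w m =
     \<lfloor>real_of_int b / (real_of_int b - real m * johnson_radius_inv p (real w / real m))\<rfloor>"

(* The closed form of the inverse, and the fact that the Johnson radius is a bijection of
   its domain, so that inv_into above is a genuine two-sided inverse there. *)
lemma johnson_radius_mem:
  assumes "2 \<le> p" "\<delta> \<in> johnson_domain p"
  shows "johnson_radius p \<delta> \<in> johnson_domain p"
    and "2 * johnson_radius p \<delta> - real p / (real p - 1) * (johnson_radius p \<delta>)\<^sup>2 = \<delta>"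
proof -
  define q where "q = real p / (real p - 1)"
  define s where "s = sqrt (1 - q * \<delta>)"
  have q: "q > 0" "1 - 1 / real p = 1 / q" "(real p - 1) / real p = 1 / q"
    using assms(1) by (auto simp: q_def field_simps)
  have d: "0 \<le> \<delta>" "q * \<delta> \<le> 1"
    using assms(2) q by (auto simp: johnson_domain_def field_simps)
  have s: "0 \<le> s" "s \<le> 1" "s\<^sup>2 = 1 - q * \<delta>"
    using d q(1) by (auto simp: s_def)
  have J: "johnson_radius p \<delta> = (1 - s) / q"
    using q(2) by (simp add: johnson_radius_def s_def q_def)
  show "johnson_radius p \<delta> \<in> johnson_domain p"
    using s q(1) by (simp add: J johnson_domain_def q(3) divide_right_mono)
  have "2 * ((1 - s) / q) - q * ((1 - s) / q)\<^sup>2 = (1 - s\<^sup>2) / q"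
    using q(1) by (simp add: field_simps power2_eq_square)
  also have "\<dots> = \<delta>"
    using q(1) by (simp add: s(3))
  finally show "2 * johnson_radius p \<delta> - real p / (real p - 1) * (johnson_radius p \<delta>)\<^sup>2 = \<delta>"
    by (simp add: J q_def)
qed

lemma johnson_radius_closed_form:
  assumes "2 \<le> p" "\<omega> \<in> johnson_domain p"
  shows "2 * \<omega> - real p / (real p - 1) * \<omega>\<^sup>2 \<in> johnson_domain p"
    and "johnson_radius p (2 * \<omega> - real p / (real p - 1) * \<omega>\<^sup>2) = \<omega>"
proof -
  define q where "q = real p / (real p - 1)"
  have q: "q > 0" "1 - 1 / real p = 1 / q" "(real p - 1) / real p = 1 / q"
    using assms(1) by (auto simp: q_def field_simps)
  have w: "0 \<le> \<omega>" "q * \<omega> \<le> 1"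
    using assms(2) q by (auto simp: johnson_domain_def field_simps)
  have sq: "1 - q * (2 * \<omega> - q * \<omega>\<^sup>2) = (1 - q * \<omega>)\<^sup>2"
    by (simp add: algebra_simps power2_eq_square)
  have "q * (2 * \<omega> - q * \<omega>\<^sup>2) \<le> 1"
    using sq zero_le_power2[of "1 - q * \<omega>"] by linarith
  then have "2 * \<omega> - q * \<omega>\<^sup>2 \<le> 1 / q"
    using q(1) by (simp add: pos_le_divide_eq mult.commute)
  moreover have "0 \<le> \<omega> * (2 - q * \<omega>)"
    using w by simp
  then have "0 \<le> 2 * \<omega> - q * \<omega>\<^sup>2"
    by (simp add: algebra_simps power2_eq_square)
  ultimately show "2 * \<omega> - real p / (real p - 1) * \<omega>\<^sup>2 \<in> johnson_domain p"
    by (simp add: johnson_domain_def q(3) flip: q_def)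
  have "sqrt (1 - q * (2 * \<omega> - q * \<omega>\<^sup>2)) = 1 - q * \<omega>"
    using w by (simp add: sq)
  then show "johnson_radius p (2 * \<omega> - real p / (real p - 1) * \<omega>\<^sup>2) = \<omega>"
    using q by (simp add: johnson_radius_def flip: q_def)
qed

lemma bij_betw_johnson_radius:
  assumes "2 \<le> p"
  shows "bij_betw (johnson_radius p) (johnson_domain p) (johnson_domain p)"
  by (rule bij_betw_byWitness[where f' = "\<lambda>\<omega>. 2 * \<omega> - real p / (real p - 1) * \<omega>\<^sup>2"])
     (use assms johnson_radius_mem johnson_radius_closed_form in auto)

lemma johnson_radius_inv_eq:
  assumes "2 \<le> p" "\<omega> \<in> johnson_domain p"
  shows "johnson_radius_inv p \<omega> = 2 * \<omega> - real p / (real p - 1) * \<omega>\<^sup>2"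
  unfolding johnson_radius_inv_def
  using bij_betw_imp_inj_on[OF bij_betw_johnson_radius[OF assms(1)]]
    johnson_radius_closed_form[OF assms]
  by (rule inv_into_f_eq)

end

theory Submission
  imports Defs
begin

text \<open>
  Replace each entry of a vector \<open>x\<close> over \<open>\<int>/p\<close> by the corresponding vertex of a regular
  simplex with unit vertices centred at the origin of \<open>\<real>\<^sup>p\<^sup>-\<^sup>1\<close>, and concatenate.
  Two vertices have inner product \<open>1\<close> or \<open>-1/(p-1)\<close> according to whether they are equal, so with
  \<open>q = p/(p-1)\<close> the resulting points satisfy \<open>\<langle>\<phi> x, \<phi> y\<rangle> = m - q d(x,y)\<close>
  (\<open>ex_simplex_embedding\<close>).

  The image of the Hamming sphere of radius \<open>w\<close> about \<open>0\<close> lies in the intersection of a Euclidean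
  sphere with the hyperplane \<open>\<langle>u, \<phi> 0\<rangle> = m - q w\<close>. Moving the origin to the centre
  \<open>(1 - q w/m) \<phi> 0\<close> of that smaller sphere makes the inner products as small as a shift along
  \<open>\<phi> 0\<close> can; they become \<open>q (A - d(x,y))\<close> with \<open>A = m (2 s - q s\<^sup>2)\<close> for
  \<open>s = w/m\<close> (\<open>centred_inner\<close>). So \<open>q A\<close> is the squared radius. For \<open>s\<close> in the domain of \<open>J\<close>, \<open>A\<close> is
  \<open>m J\<inverse>(s)\<close>; the condition \<open>s < J(b/m)\<close> therefore gives \<open>A < b\<close> (\<open>johnson_condition\<close>), and two
  words at distance at least \<open>b\<close> are sent to points at an obtuse angle. Dividing by the radius gives the embedding \<open>f\<close>.

  Both bounds are then facts about unit vectors with negative inner products. Leaving out one of them,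
  the others are linearly independent, so there are at most \<open>dim + 1\<close> of them
  (\<open>card_obtuse_le\<close>). Moreover the inner products are at most \<open>-t\<close> with \<open>t = b/A - 1\<close>, and
  nonnegativity of the squared norm of their sum bounds their number by
  \<open>(1 + t)/t = b/(b - A)\<close> (\<open>card_uniformly_obtuse_le\<close>).

  The radius can vanish, for \<open>w = 0\<close> and for \<open>p = 2\<close>, \<open>w = m\<close>; the points \<open>\<phi> x\<close> then all coincide with
  the centre, so by injectivity of \<open>\<phi>\<close> the Hamming sphere has a single point. Hence one-point spheres
  are treated apart, where any constant unit vector serves as \<open>f\<close>, and otherwise the radius is positive.
\<close>

section \<open>Families of vectors at obtuse angles\<close>

text \<open>
  In a linear relation, move the terms with nonpositive coefficients to the other side. The
  common value \<open>z\<close> of the two sides has \<open>\<langle>z, z\<rangle> \<le> 0\<close>, because only products of distinct vectors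
  occur, so \<open>z = 0\<close>. Pairing \<open>z\<close> with \<open>v\<close> then excludes positive coefficients; the negated relation
  excludes negative ones.
\<close>
lemma independent_if_obtuse:
  fixes S :: "'a::euclidean_space set"
  assumes fin: "finite S"
    and neg: "\<And>u v. u \<in> S \<Longrightarrow> v \<in> S \<Longrightarrow> u \<noteq> v \<Longrightarrow> u \<bullet> v < 0"
    and v: "\<And>u. u \<in> S \<Longrightarrow> u \<bullet> v < 0"
  shows "independent S"
proof -
  have no_pos: "\<not> (\<exists>u\<in>S. 0 < c u)" if c: "(\<Sum>u\<in>S. c u *\<^sub>R u) = 0" for c
  proof
    assume ex: "\<exists>u\<in>S. 0 < c u"
    define P where "P = {u \<in> S. 0 < c u}"
    define Q where "Q = {u \<in> S. \<not> 0 < c u}"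
    have PQ: "finite P" "finite Q" "P \<inter> Q = {}" "S = P \<union> Q"
      using fin by (auto simp: P_def Q_def)
    define z where "z = (\<Sum>u\<in>P. c u *\<^sub>R u)"
    have z2: "z = - (\<Sum>u\<in>Q. c u *\<^sub>R u)"
      using c PQ by (simp add: z_def sum.union_disjoint eq_neg_iff_add_eq_0)
    have "z \<bullet> z = (\<Sum>u'\<in>Q. \<Sum>u\<in>P. c u * (- c u') * (u \<bullet> u'))"
      by (subst (2) z2) (simp add: z_def inner_sum_left inner_sum_right sum_negf sum_distrib_left mult_ac)
    also have "\<dots> \<le> 0"
    proof (intro sum_nonpos)
      fix u u' assume "u \<in> P" "u' \<in> Q"
      then have "0 \<le> c u * (- c u')" "u \<bullet> u' < 0"
        using neg[of u u'] by (auto simp: P_def Q_def mult_nonneg_nonpos)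
      then show "c u * (- c u') * (u \<bullet> u') \<le> 0"
        by (intro mult_nonneg_nonpos) auto
    qed
    finally have "z = 0" by (metis inner_gt_zero_iff not_le)
    then have "(\<Sum>u\<in>P. c u * (u \<bullet> v)) = 0"
      by (simp add: z_def flip: inner_scaleR_left inner_sum_left)
    moreover have "(\<Sum>u\<in>P. c u * (u \<bullet> v)) < (\<Sum>u\<in>P. 0)"
      using ex v PQ(1) by (intro sum_strict_mono) (auto simp: P_def mult_pos_neg)
    ultimately show False by simp
  qed
  show ?thesis
  proof
    assume "dependent S"
    then obtain c u where c: "(\<Sum>u\<in>S. c u *\<^sub>R u) = 0" and u: "u \<in> S" "c u \<noteq> 0"
      unfolding dependent_finite[OF fin] by blast
    have "(\<Sum>u\<in>S. (- c u) *\<^sub>R u) = 0"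
      using c by (simp add: sum_negf)
    from no_pos[OF c] no_pos[OF this] u show False
      by (metis linorder_cases neg_0_less_iff_less)
  qed
qed

lemma card_obtuse_le:
  fixes S :: "'a::euclidean_space set"
  assumes fin: "finite S"
    and neg: "\<And>u v. u \<in> S \<Longrightarrow> v \<in> S \<Longrightarrow> u \<noteq> v \<Longrightarrow> u \<bullet> v < 0"
  shows "card S \<le> DIM('a) + 1"
proof (cases "S = {}")
  case False
  then obtain v where v: "v \<in> S" by blast
  have "independent (S - {v})"
    by (rule independent_if_obtuse[where v = v]) (use fin neg v in auto)
  then have "card (S - {v}) \<le> DIM('a)"
    by (rule independent_bound[THEN conjunct2])
  then show ?thesis
    using v fin by (simp add: card_Diff_singleton)
qed simp

text \<open>
  The squared norm of the sum of \<open>k\<close> such vectors is at most \<open>k - k (k - 1) t\<close>, and it is nonnegative.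
\<close>
lemma card_uniformly_obtuse_le:
  fixes S :: "'a::real_inner set"
  assumes fin: "finite S" and unit: "\<And>u. u \<in> S \<Longrightarrow> norm u = 1"
    and sep: "\<And>u v. u \<in> S \<Longrightarrow> v \<in> S \<Longrightarrow> u \<noteq> v \<Longrightarrow> u \<bullet> v \<le> - t"
    and t: "0 \<le> t"
  shows "real (card S) * t \<le> 1 + t"
proof (cases "S = {}")
  case False
  let ?k = "real (card S)"
  have "0 \<le> (\<Sum>u\<in>S. u) \<bullet> (\<Sum>u\<in>S. u)" by simp
  also have "\<dots> = (\<Sum>u\<in>S. \<Sum>v\<in>S. u \<bullet> v)"
    by (simp add: inner_sum_left inner_sum_right) (rule sum.swap)
  also have "\<dots> \<le> (\<Sum>u\<in>S. \<Sum>v\<in>S. (if u = v then 1 + t else 0) - t)"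
    using unit sep by (intro sum_mono) (auto simp: dot_square_norm)
  also have "\<dots> = ?k * (1 + t - ?k * t)"
    by (simp add: sum_subtractf sum.delta[OF fin] sum.delta'[OF fin] algebra_simps)
  finally show ?thesis
    using False fin by (simp add: zero_le_mult_iff card_gt_0_iff)
qed (simp add: t)

section \<open>Coordinates of a regular simplex\<close>

text \<open>
  Row \<open>a\<close> holds the coordinates, indexed by \<open>1..n\<close>, of the \<open>a\<close>-th of the \<open>n + 1\<close> vertices of a regular
  simplex inscribed in the unit sphere of \<open>\<real>\<^sup>n\<close>. Vertex \<open>0\<close> lies on the negative diagonal.
  Vertex \<open>a \<ge> 1\<close> has the form \<open>\<alpha> e\<^sub>a + \<beta> (1, \<dots>, 1)\<close>, which respects the
  symmetry of the remaining vertices; its product with vertex \<open>0\<close> being \<open>-1/n\<close> means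
  \<open>\<alpha> + n \<beta> = 1/\<surd>n\<close>, and then unit length forces \<open>\<alpha>\<^sup>2 = (n + 1)/n\<close>.
\<close>
definition simplex_coord :: "nat \<Rightarrow> int \<Rightarrow> int \<Rightarrow> real" where
  "simplex_coord n a c =
     (if a = c then sqrt ((real n + 1) / real n) else 0) +
     (if a = 0 then - 1 / sqrt (real n)
      else (1 / sqrt (real n) - sqrt ((real n + 1) / real n)) / real n)"

lemma simplex_coord_inner:
  assumes n: "1 \<le> n" and a: "a \<in> {0..int n}" and b: "b \<in> {0..int n}"
  shows "(\<Sum>c\<in>{1..int n}. simplex_coord n a c * simplex_coord n b c) =
           (if a = b then 1 else - 1 / real n)"
proof -
  define \<alpha> where "\<alpha> = sqrt ((real n + 1) / real n)"
  define \<sigma> where "\<sigma> = 1 / sqrt (real n)"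
  define \<beta> where "\<beta> = (\<sigma> - \<alpha>) / real n"
  define \<kappa> where "\<kappa> a = (if a = 0 then - \<sigma> else \<beta>)" for a :: int
  have s: "simplex_coord n a c = (if a = c then \<alpha> else 0) + \<kappa> a" for a c
    by (simp add: simplex_coord_def \<kappa>_def \<alpha>_def \<beta>_def \<sigma>_def)
  have sq: "\<alpha> * \<alpha> = 1 + 1 / real n" "\<sigma> * \<sigma> = 1 / real n" "real n * \<beta> = \<sigma> - \<alpha>"
    using n by (auto simp: \<alpha>_def \<beta>_def \<sigma>_def field_simps)
  have \<beta>: "2 * (\<alpha> * \<beta>) + real n * (\<beta> * \<beta>) = - 1 / real n"
  proof -
    have "real n * (2 * (\<alpha> * \<beta>) + real n * (\<beta> * \<beta>)) =
            2 * \<alpha> * (real n * \<beta>) + (real n * \<beta>) * (real n * \<beta>)"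
      by (simp add: algebra_simps)
    also have "\<dots> = \<sigma> * \<sigma> - \<alpha> * \<alpha>"
      unfolding sq(3) by (simp add: algebra_simps)
    also have "\<dots> = - 1" by (simp add: sq)
    finally show ?thesis using n by (simp add: field_simps)
  qed
  have \<sigma>: "\<alpha> * \<sigma> + real n * (\<beta> * \<sigma>) = 1 / real n"
  proof -
    have "\<alpha> * \<sigma> + real n * (\<beta> * \<sigma>) = (\<alpha> + real n * \<beta>) * \<sigma>" by (simp add: algebra_simps)
    then show ?thesis by (simp add: sq)
  qed
  have "(\<Sum>c\<in>{1..int n}. simplex_coord n a c * simplex_coord n b c) =
      (\<Sum>c\<in>{1..int n}. (if a = c then (if a = b then \<alpha> * \<alpha> else 0) else 0)
         + (if a = c then \<alpha> * \<kappa> b else 0) + (if b = c then \<alpha> * \<kappa> a else 0) + \<kappa> a * \<kappa> b)"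
    by (intro sum.cong) (auto simp: s algebra_simps)
  also have "\<dots> = (if a \<noteq> 0 \<and> a = b then \<alpha> * \<alpha> else 0) + (if a \<noteq> 0 then \<alpha> * \<kappa> b else 0)
      + (if b \<noteq> 0 then \<alpha> * \<kappa> a else 0) + real n * (\<kappa> a * \<kappa> b)"
    using a b by (auto simp: sum.distrib)
  also have "\<dots> = (if a = b then 1 else - 1 / real n)"
  proof -
    have 1: "real n * (\<sigma> * \<sigma>) = 1" using n by (simp add: sq)
    show ?thesis
      using 1 \<beta> \<sigma> sq(1) by (auto simp: \<kappa>_def mult.commute)
  qed
  finally show ?thesis .
qed

section \<open>Hamming distances as inner products\<close>

lemma hamming_dist_eq:
  assumes "2 \<le> p" "x \<in> residue_vectors p m" "y \<in> residue_vectors p m"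
  shows "hamming_dist p m x y = card {i \<in> {..<m}. x i \<noteq> y i}"
proof -
  interpret residues "int p" "residue_ring (int p)"
    by unfold_locales (use assms in auto)
  have "x i \<in> carrier (residue_ring (int p))" "y i \<in> carrier (residue_ring (int p))"
    if "i < m" for i
    using assms that by (auto simp: residue_vectors_def)
  then show ?thesis
    unfolding hamming_dist_def hamming_weight_def residue_vector_diff_def
    by (intro arg_cong[where f = card]) (auto simp: r_right_minus_eq)
qed

definition zero_vector :: "nat \<Rightarrow> nat \<Rightarrow> int" where
  "zero_vector m = (\<lambda>i\<in>{..<m}. 0)"

lemma zero_vector_in: "2 \<le> p \<Longrightarrow> zero_vector m \<in> residue_vectors p m"
  by (auto simp: zero_vector_def residue_vectors_def residue_ring_def)

lemma hamming_dist_zero_vector: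
  assumes "2 \<le> p" "x \<in> residue_vectors p m"
  shows "hamming_dist p m x (zero_vector m) = hamming_weight p m x"
  unfolding hamming_dist_eq[OF assms zero_vector_in[OF assms(1)]] hamming_weight_def
  by (intro arg_cong[where f = card]) (auto simp: zero_vector_def residue_ring_def)

lemma hamming_dist_refl:
  "2 \<le> p \<Longrightarrow> x \<in> residue_vectors p m \<Longrightarrow> hamming_dist p m x x = 0"
  by (simp add: hamming_dist_eq)

lemma hamming_dist_eq_0_imp_eq:
  assumes "2 \<le> p" and x: "x \<in> residue_vectors p m" and y: "y \<in> residue_vectors p m"
    and "hamming_dist p m x y = 0"
  shows "x = y"
proof (rule PiE_ext[OF x[unfolded residue_vectors_def] y[unfolded residue_vectors_def]])
  show "x i = y i" if "i \<in> {..<m}" for i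
    using assms(4) that unfolding hamming_dist_eq[OF assms(1) x y] by auto
qed

lemma finite_hamming_sphere: "finite (hamming_sphere p m w)"
proof (rule finite_subset)
  show "hamming_sphere p m w \<subseteq> residue_vectors p m"
    by (auto simp: hamming_sphere_def)
  show "finite (residue_vectors p m)"
    unfolding residue_vectors_def by (intro finite_PiE) (auto simp: residue_ring_def)
qed

text \<open>
  The dimension \<open>(p - 1) m\<close> is the number of pairs of a position and a simplex coordinate, so the
  abstract index type is enumerated by such pairs.
\<close>
lemma ex_simplex_embedding:
  assumes p: "2 \<le> p" and card: "CARD('n::finite) = (p - 1) * m"
  shows "\<exists>\<phi> :: (nat \<Rightarrow> int) \<Rightarrow> real ^ 'n.
           \<forall>x\<in>residue_vectors p m. \<forall>y\<in>residue_vectors p m.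
             \<phi> x \<bullet> \<phi> y = real m - real p / (real p - 1) * real (hamming_dist p m x y)"
proof -
  let ?n = "p - 1"
  let ?I = "{..<m} \<times> {1..int ?n}"
  have "card (UNIV :: 'n set) = card ?I"
    using card by (simp add: card_cartesian_product)
  then obtain h :: "'n \<Rightarrow> nat \<times> int" where h: "bij_betw h UNIV ?I"
    using finite_same_card_bij[of "UNIV :: 'n set" ?I] by auto
  define \<phi> :: "(nat \<Rightarrow> int) \<Rightarrow> real ^ 'n"
    where "\<phi> x = (\<chi> j. simplex_coord ?n (x (fst (h j))) (snd (h j)))" for x
  have "\<phi> x \<bullet> \<phi> y = real m - real p / (real p - 1) * real (hamming_dist p m x y)"
    if x: "x \<in> residue_vectors p m" and y: "y \<in> residue_vectors p m" for x y
  proof -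
    have range: "x i \<in> {0..int ?n}" "y i \<in> {0..int ?n}" if "i < m" for i
      using x y p that by (auto simp: residue_vectors_def residue_ring_def PiE_iff)
    have "\<phi> x \<bullet> \<phi> y =
        (\<Sum>(i, c)\<in>?I. simplex_coord ?n (x i) c * simplex_coord ?n (y i) c)"
      unfolding sum.reindex_bij_betw[OF h, symmetric]
      by (simp add: inner_vec_def \<phi>_def case_prod_beta)
    also have "\<dots> = (\<Sum>i<m. \<Sum>c\<in>{1..int ?n}. simplex_coord ?n (x i) c * simplex_coord ?n (y i) c)"
      by (simp only: sum.cartesian_product)
    also have "\<dots> = (\<Sum>i<m. if x i = y i then 1 else - 1 / real ?n)"
      using p range by (intro sum.cong refl simplex_coord_inner) auto
    also have "\<dots> = (\<Sum>i<m. 1 - real p / (real p - 1) * (if x i \<noteq> y i then 1 else 0))"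
      using p by (intro sum.cong) (auto simp: field_simps of_nat_diff)
    also have "\<dots> = real m - real p / (real p - 1) * real (hamming_dist p m x y)"
      by (simp add: sum_subtractf hamming_dist_eq[OF p x y] flip: sum_distrib_left sum.inter_filter
          del: times_divide_eq_left)
    finally show ?thesis .
  qed
  then show ?thesis by blast
qed

section \<open>The Johnson radius as an angle condition\<close>

text \<open>
  The factor \<open>l\<close> is the one for which \<open>l c\<close> is the orthogonal projection of \<open>u\<close> and of \<open>v\<close> onto the
  line through \<open>c\<close>; equivalently, it minimises the inner product on the left as a
  quadratic in \<open>l\<close>.
\<close>
lemma centred_inner:
  fixes u v c :: "'a::real_inner" and M q d w :: real
  assumes M: "M \<noteq> 0" and "u \<bullet> v = M - q * d" and "u \<bullet> c = M - q * w" "v \<bullet> c = M - q * w"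
    and "c \<bullet> c = M" and l: "l = 1 - q * (w / M)"
  shows "(u - l *\<^sub>R c) \<bullet> (v - l *\<^sub>R c) = q * (M * (2 * (w / M) - q * (w / M)\<^sup>2) - d)"
proof -
  define s where "s = w / M"
  have w: "w = M * s" using M by (simp add: s_def)
  have "(u - l *\<^sub>R c) \<bullet> (v - l *\<^sub>R c) = u \<bullet> v - l * (u \<bullet> c) - l * (v \<bullet> c) + l * l * (c \<bullet> c)"
    by (simp add: inner_diff_left inner_diff_right inner_commute algebra_simps)
  also have "\<dots> = (M - q * d) - l * (M - q * (M * s)) - l * (M - q * (M * s)) + l * l * M"
    using assms(2-5) w by simp
  also have "\<dots> = q * (M * (2 * s - q * s\<^sup>2) - d)"
    unfolding l s_def[symmetric] by (simp add: algebra_simps power2_eq_square)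
  finally show ?thesis by (simp add: s_def)
qed

text \<open>
  The inverse \<open>2 s - q s\<^sup>2\<close> increases up to its vertex \<open>s = 1/q\<close>, the right end of the
  domain; applying it to both sides of the hypothesis gives \<open>A < b\<close>.
\<close>
lemma johnson_condition:
  assumes p: "2 \<le> p" and m: "1 \<le> m" and b: "b / real m \<in> johnson_domain p"
    and w: "real w / real m < johnson_radius p (b / real m)"
  defines "A \<equiv> real m * johnson_radius_inv p (real w / real m)"
  shows "A = real m * (2 * (real w / real m) - real p / (real p - 1) * (real w / real m)\<^sup>2)"
    and "0 \<le> A" and "A < b"
proof -
  define q where "q = real p / (real p - 1)"
  have q: "q > 0" "(real p - 1) / real p = 1 / q" using p by (auto simp: q_def)
  let ?s = "real w / real m" and ?J = "johnson_radius p (b / real m)"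
  note J = johnson_radius_mem[OF p b, folded q_def]
  have s: "?s \<in> johnson_domain p"
    using J(1) w by (auto simp: johnson_domain_def)
  have inv: "johnson_radius_inv p ?s = 2 * ?s - q * ?s\<^sup>2"
    using johnson_radius_inv_eq[OF p s] by (simp add: q_def)
  then show "A = real m * (2 * ?s - real p / (real p - 1) * ?s\<^sup>2)"
    by (simp add: A_def q_def)
  show "0 \<le> A"
    using johnson_radius_closed_form(1)[OF p s] inv
    by (simp add: A_def johnson_domain_def q_def)
  have "?J \<le> 1 / q" using J(1) by (simp add: johnson_domain_def q(2))
  then have "q * ?J \<le> 1" using q(1) by (simp add: field_simps)
  moreover have "q * ?s < q * ?J" by (rule mult_strict_left_mono[OF w q(1)])
  \<comment> \<open>This product is the difference of the values of the quadratic at the two arguments.\<close>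
  ultimately have "0 < (?J - ?s) * (2 - q * ?J - q * ?s)"
    using w by (intro mult_pos_pos) linarith+
  then have "2 * ?s - q * ?s\<^sup>2 < 2 * ?J - q * ?J\<^sup>2"
    by (simp add: algebra_simps power2_eq_square)
  then have "johnson_radius_inv p ?s < b / real m"
    by (simp add: inv J(2))
  then show "A < b"
    using m by (simp add: A_def field_simps)
qed

section \<open>The Johnson bound\<close>

theorem theoremC:
  fixes p m w :: nat
  assumes "2 \<le> p" and "1 \<le> m" and "w \<le> m"
    and "CARD('n::finite) = (p - 1) * m"
  shows "\<exists>f :: (nat \<Rightarrow> int) \<Rightarrow> real ^ 'n.
           inj_on f (hamming_sphere p m w) \<and>
           f ` hamming_sphere p m w \<subseteq> sphere 0 1 \<and>
           (\<forall>(b :: int) C.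
              b \<le> int m \<longrightarrow>
              real_of_int b / real m \<in> johnson_domain p \<longrightarrow>
              real w / real m < johnson_radius p (real_of_int b / real m) \<longrightarrow>
              C \<subseteq> hamming_sphere p m w \<longrightarrow>
              (\<forall>x\<in>C. \<forall>y\<in>C. x \<noteq> y \<longrightarrow> b \<le> int (hamming_dist p m x y)) \<longrightarrow>
              (\<forall>x\<in>C. \<forall>y\<in>C. x \<noteq> y \<longrightarrow> f x \<bullet> f y < 0) \<and>
              int (card C) \<le> min (int ((p - 1) * m + 1)) (johnson_gamma p b w m))"
proof -
  let ?S = "hamming_sphere p m w"
  define q where "q = real p / (real p - 1)"
  define s where "s = real w / real m"
  define A where "A = real m * (2 * s - q * s\<^sup>2)"
  have q: "q > 0" using assms(1) by (simp add: q_def)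
  note condition = johnson_condition[OF assms(1,2), where w = w, folded q_def s_def]
  have inv: "real m * johnson_radius_inv p s = A"
    if "b / real m \<in> johnson_domain p" "s < johnson_radius p (b / real m)" for b
    unfolding A_def by (rule condition(1)[OF that])
  have A: "0 \<le> A" "A < b"
    if "b / real m \<in> johnson_domain p" "s < johnson_radius p (b / real m)" for b
    using condition(2,3)[OF that] unfolding inv[OF that] .
  show ?thesis
  proof (cases "\<exists>x\<in>?S. \<exists>y\<in>?S. x \<noteq> y")
    case False
    obtain e :: "real ^ 'n" where e: "norm e = 1"
      using vector_choose_size[of 1] by auto
    have "(\<forall>x\<in>C. \<forall>y\<in>C. x \<noteq> y \<longrightarrow> e \<bullet> e < 0) \<and>
        int (card C) \<le> min (int ((p - 1) * m + 1)) (johnson_gamma p b w m)"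
      if b: "real_of_int b / real m \<in> johnson_domain p"
        "real w / real m < johnson_radius p (real_of_int b / real m)"
        and C: "C \<subseteq> ?S" for b C
    proof -
      note b' = b[folded s_def]
      have single: "card C \<le> 1"
        using False C finite_subset[OF C finite_hamming_sphere]
        by (auto simp: card_le_Suc0_iff_eq)
      have gamma: "1 \<le> johnson_gamma p b w m"
        using A[OF b'] inv[OF b'] by (simp add: johnson_gamma_def le_floor_iff flip: s_def)
      have "int (card C) \<le> int ((p - 1) * m + 1)"
        using single by (intro of_nat_mono) simp
      with single gamma have "int (card C) \<le> min (int ((p - 1) * m + 1)) (johnson_gamma p b w m)"
        by (intro min.boundedI) linarith+
      moreover have "\<forall>x\<in>C. \<forall>y\<in>C. x = y"
        using False C by blast
      ultimately show ?thesis by blast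
    qed
    with False e show ?thesis
      by (intro exI[of _ "\<lambda>_. e"]) (auto simp: inj_on_def)
  next
    case True
    obtain \<phi> :: "(nat \<Rightarrow> int) \<Rightarrow> real ^ 'n" where \<phi>:
      "\<And>x y. x \<in> residue_vectors p m \<Longrightarrow> y \<in> residue_vectors p m \<Longrightarrow>
         \<phi> x \<bullet> \<phi> y = real m - q * real (hamming_dist p m x y)"
      using ex_simplex_embedding[OF assms(1,4)] unfolding q_def by blast
    define z where "z = zero_vector m"
    have z: "z \<in> residue_vectors p m"
      using assms(1) by (simp add: z_def zero_vector_in)
    define g where "g x = \<phi> x - (1 - q * s) *\<^sub>R \<phi> z" for x
    have res: "x \<in> residue_vectors p m" if "x \<in> ?S" for x
      using that by (simp add: hamming_sphere_def)
    have \<phi>z: "\<phi> x \<bullet> \<phi> z = real m - q * real w" if "x \<in> ?S" for x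
      using \<phi>[OF res[OF that] z] hamming_dist_zero_vector[OF assms(1) res[OF that]] that
      by (simp add: z_def hamming_sphere_def)
    have g: "g x \<bullet> g y = q * (A - real (hamming_dist p m x y))"
      if "x \<in> ?S" "y \<in> ?S" for x y
      unfolding g_def A_def s_def
      using assms(2) \<phi>[OF res[OF that(1)] res[OF that(2)]] \<phi>[OF z z] \<phi>z that
      by (intro centred_inner) (auto simp: hamming_dist_refl[OF assms(1) z])
    have g_self: "g x \<bullet> g x = q * A" if "x \<in> ?S" for x
      using g[OF that that] by (simp add: hamming_dist_refl[OF assms(1) res[OF that]])
    have inj: "inj_on g ?S"
    proof (rule inj_onI)
      fix x y assume xy: "x \<in> ?S" "y \<in> ?S" "g x = g y"
      then have "hamming_dist p m x y = 0"
        using g[of x y] g_self[of x] q by simp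
      then show "x = y"
        using hamming_dist_eq_0_imp_eq[OF assms(1)] res xy by blast
    qed
    \<comment> \<open>All points of the image have squared norm \<open>q * A\<close>, and two distinct ones cannot both be \<open>0\<close>.\<close>
    have "A > 0"
    proof -
      obtain x y where xy: "x \<in> ?S" "y \<in> ?S" "x \<noteq> y" using True by blast
      then have "g x \<noteq> 0 \<or> g y \<noteq> 0" using inj by (metis inj_onD)
      then have "0 < q * A" using g_self xy by (metis inner_gt_zero_iff)
      then show ?thesis using q by (simp add: zero_less_mult_iff)
    qed
    define f where "f x = g x /\<^sub>R sqrt (q * A)" for x
    have f: "f x \<bullet> f y = 1 - real (hamming_dist p m x y) / A" if "x \<in> ?S" "y \<in> ?S" for x y
    proof -
      have "f x \<bullet> f y = (g x \<bullet> g y) / (q * A)"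
        using q \<open>A > 0\<close> by (simp add: f_def divide_simps)
      then show ?thesis
        using q \<open>A > 0\<close> by (simp add: g[OF that] divide_simps)
    qed
    have unit: "norm (f x) = 1" if "x \<in> ?S" for x
      using f[OF that that] by (simp add: hamming_dist_refl[OF assms(1) res[OF that]] norm_eq_1)
    have inj_f: "inj_on f ?S"
      using inj q \<open>A > 0\<close> by (simp add: f_def inj_on_def)
    have "(\<forall>x\<in>C. \<forall>y\<in>C. x \<noteq> y \<longrightarrow> f x \<bullet> f y < 0) \<and>
        int (card C) \<le> min (int ((p - 1) * m + 1)) (johnson_gamma p b w m)"
      if b: "real_of_int b / real m \<in> johnson_domain p"
        "real w / real m < johnson_radius p (real_of_int b / real m)"
        and C: "C \<subseteq> ?S" and d: "\<forall>x\<in>C. \<forall>y\<in>C. x \<noteq> y \<longrightarrow> b \<le> int (hamming_dist p m x y)"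
      for b C
    proof -
      note b' = b[folded s_def]
      define t where "t = real_of_int b / A - 1"
      have t: "t > 0" using A[OF b'] \<open>A > 0\<close> by (simp add: t_def)
      have sep: "f x \<bullet> f y \<le> - t" if "x \<in> C" "y \<in> C" "x \<noteq> y" for x y
      proof -
        have "real_of_int b \<le> real (hamming_dist p m x y)"
          using d that by (metis of_int_le_iff of_int_of_nat_eq)
        then have "real_of_int b / A \<le> real (hamming_dist p m x y) / A"
          using \<open>A > 0\<close> by (simp add: divide_right_mono)
        moreover have "f x \<bullet> f y = 1 - real (hamming_dist p m x y) / A"
          using C that by (intro f) auto
        ultimately show ?thesis
          unfolding t_def by linarith
      qed
      have neg: "f x \<bullet> f y < 0" if "x \<in> C" "y \<in> C" "x \<noteq> y" for x y
        using sep[OF that] t by linarith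
      have fin: "finite (f ` C)"
        using finite_subset[OF C finite_hamming_sphere] by simp
      have card: "card (f ` C) = card C"
        using inj_f C by (intro card_image) (rule inj_on_subset)
      have "card (f ` C) \<le> DIM(real ^ 'n) + 1"
        by (rule card_obtuse_le[OF fin]) (use neg in auto)
      then have dim: "card C \<le> (p - 1) * m + 1"
        using assms(4) card by simp
      have "real (card (f ` C)) * t \<le> 1 + t"
        by (rule card_uniformly_obtuse_le[OF fin]) (use unit C sep t in auto)
      then have "real (card C) * t \<le> 1 + t"
        by (simp only: card)
      then have "real (card C) \<le> (1 + t) / t"
        using t by (simp add: pos_le_divide_eq)
      also have "(1 + t) / t = real_of_int b / (real_of_int b - A)"
        using A[OF b'] \<open>A > 0\<close> by (simp add: t_def divide_simps)
      finally have "int (card C) \<le> johnson_gamma p b w m"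
        using inv[OF b'] by (simp add: johnson_gamma_def le_floor_iff flip: s_def)
      moreover have "int (card C) \<le> int ((p - 1) * m + 1)"
        using dim by (rule of_nat_mono)
      ultimately have "int (card C) \<le> min (int ((p - 1) * m + 1)) (johnson_gamma p b w m)"
        by (intro min.boundedI)
      with neg show ?thesis by blast
    qed
    with inj_f unit show ?thesis
      by (intro exI[of _ f]) auto
  qed
qed

end
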